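(* For any integer $k \geq 2$, every $2k$-connected line graph $L(G)$ has $k$ completely independent spanning trees if $G$ is not super edge-connected or $\delta(G) \geq 2k$.
   Context: All graphs are finite, simple and undirected. $L(G)$ is the line graph of $G$ (vertex set $E(G)$, two vertices adjacent iff the corresponding edges share an endpoint). $\delta(G)$ is the minimum degree of $G$. A graph is $k$-connected if its (vertex) connectivity is at least $k$. An edge-cut of a connected graph is a set of edges whose removal disconnects it; a connected graph is super edge-connected if every minimum edge-cut isolates a vertex. Spanning trees $T_1,\dots,T_k$ of a graph $H$ are completely independent if for any two distinct vertices $u,v$ of $H$, the $u$–$v$ paths in $T_1,\dots,T_k$ are pairwise edge-disjoint and pairwise share no vertex other than $u$ and $v$. *)

theory Defs imports Main begin

datatype 'a graph = Graph (verts: "'a set") (edges: "'a set set")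

definition simple_graph :: "'a graph \<Rightarrow> bool" where
  "simple_graph G \<longleftrightarrow>
     finite (verts G) \<and> (\<forall>e\<in>edges G. e \<subseteq> verts G \<and> card e = 2)"

definition degree :: "'a graph \<Rightarrow> 'a \<Rightarrow> nat" where
  "degree G v = card {e \<in> edges G. v \<in> e}"

definition min_degree :: "'a graph \<Rightarrow> nat" where
  "min_degree G = Min (degree G ` verts G)"

definition line_graph :: "'a graph \<Rightarrow> 'a set graph" where
  "line_graph G =
     Graph (edges G) {{e, f} | e f. e \<in> edges G \<and> f \<in> edges G \<and> e \<noteq> f \<and> e \<inter> f \<noteq> {}}"

text \<open>A path is given by its list of (pairwise distinct) vertices.\<close>

definition path :: "'a graph \<Rightarrow> 'a \<Rightarrow> 'a list \<Rightarrow> 'a \<Rightarrow> bool" where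
  "path G u p v \<longleftrightarrow>
     p \<noteq> [] \<and> hd p = u \<and> last p = v \<and> distinct p \<and> set p \<subseteq> verts G \<and>
     successively (\<lambda>x y. {x, y} \<in> edges G) p"

definition path_edges :: "'a list \<Rightarrow> 'a set set" where
  "path_edges p = {{p ! i, p ! Suc i} | i. Suc i < length p}"

text \<open>The graph without vertices does not count as connected.\<close>

definition connected_graph :: "'a graph \<Rightarrow> bool" where
  "connected_graph G \<longleftrightarrow>
     verts G \<noteq> {} \<and> (\<forall>u\<in>verts G. \<forall>v\<in>verts G. \<exists>p. path G u p v)"

definition del_verts :: "'a graph \<Rightarrow> 'a set \<Rightarrow> 'a graph" where
  "del_verts G S = Graph (verts G - S) {e \<in> edges G. e \<inter> S = {}}"

definition del_edges :: "'a graph \<Rightarrow> 'a set set \<Rightarrow> 'a graph" where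
  "del_edges G F = Graph (verts G) (edges G - F)"

text \<open>The usual convention for complete graphs: the connectivity is the least number of vertices
  whose removal leaves a disconnected graph or at most one vertex, so that the connectivity of
  the complete graph on \<open>n\<close> vertices is \<open>n - 1\<close>.\<close>

definition vertex_connectivity :: "'a graph \<Rightarrow> nat" where
  "vertex_connectivity G =
     (LEAST n. \<exists>S\<subseteq>verts G. card S = n \<and>
        (\<not> connected_graph (del_verts G S) \<or> card (verts G - S) \<le> 1))"

definition k_connected :: "nat \<Rightarrow> 'a graph \<Rightarrow> bool" where
  "k_connected k G \<longleftrightarrow> k \<le> vertex_connectivity G"

definition edge_cut :: "'a graph \<Rightarrow> 'a set set \<Rightarrow> bool" where
  "edge_cut G F \<longleftrightarrow> F \<subseteq> edges G \<and> \<not> connected_graph (del_edges G F)"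

definition minimum_edge_cut :: "'a graph \<Rightarrow> 'a set set \<Rightarrow> bool" where
  "minimum_edge_cut G F \<longleftrightarrow>
     edge_cut G F \<and> (\<forall>F'. edge_cut G F' \<longrightarrow> card F \<le> card F')"

text \<open>The notion concerns connected graphs only. As \<open>\<not> super_edge_connected G\<close> also holds for every
  disconnected \<open>G\<close>, "\<open>G\<close> is not super edge-connected" has to be stated together with
  \<open>connected_graph G\<close>.\<close>

definition super_edge_connected :: "'a graph \<Rightarrow> bool" where
  "super_edge_connected G \<longleftrightarrow>
     connected_graph G \<and>
     (\<forall>F. minimum_edge_cut G F \<longrightarrow> (\<exists>v\<in>verts G. degree (del_edges G F) v = 0))"

definition cycle :: "'a graph \<Rightarrow> 'a list \<Rightarrow> bool" where
  "cycle G c \<longleftrightarrow> 3 \<le> length c \<and> path G (hd c) c (last c) \<and> {last c, hd c} \<in> edges G"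

definition tree :: "'a graph \<Rightarrow> bool" where
  "tree T \<longleftrightarrow> simple_graph T \<and> connected_graph T \<and> (\<nexists>c. cycle T c)"

definition spanning_tree :: "'a graph \<Rightarrow> 'a graph \<Rightarrow> bool" where
  "spanning_tree H T \<longleftrightarrow> tree T \<and> verts T = verts H \<and> edges T \<subseteq> edges H"

definition completely_independent_spanning_trees ::
    "'a graph \<Rightarrow> nat \<Rightarrow> (nat \<Rightarrow> 'a graph) \<Rightarrow> bool" where
  "completely_independent_spanning_trees H k T \<longleftrightarrow>
     (\<forall>i<k. spanning_tree H (T i)) \<and>
     (\<forall>u\<in>verts H. \<forall>v\<in>verts H. u \<noteq> v \<longrightarrow>
        (\<forall>i<k. \<forall>j<k. i \<noteq> j \<longrightarrow>
           (\<forall>p q. path (T i) u p v \<and> path (T j) u q v \<longrightarrow>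
              path_edges p \<inter> path_edges q = {} \<and> set p \<inter> set q \<subseteq> {u, v})))"

end

theory Submission imports Defs begin

text \<open>
  Either alternative forces every edge cut of \<open>G\<close> to have at least \<open>2k\<close> edges: a cut with edges on
  both sides is a vertex cut of \<open>L(G)\<close>, and a side without edges contributes a full vertex star.
  By the tree packing theorem of Nash-Williams and Tutte, \<open>G\<close> then has \<open>k\<close> edge-disjoint spanning
  trees. Each of them induces a connected subgraph of \<open>L(G)\<close>, which is completed to a spanning tree
  of \<open>L(G)\<close> by hanging every other edge of \<open>G\<close> onto it as a leaf; trees whose sets of inner vertices
  are disjoint are completely independent as soon as they are edge-disjoint. To make them so, root
  all trees of \<open>G\<close> at one vertex and let an edge \<open>f\<close> of the \<open>j\<close>-th tree be attached to the \<open>i\<close>-th tree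
  at the child end of \<open>f\<close> if \<open>j < i\<close> and at its parent end if \<open>i < j\<close>.
\<close>

section \<open>Connectivity of edge sets and forests\<close>

definition adj :: "'a set set \<Rightarrow> ('a \<times> 'a) set" where
  "adj A = {(x, y). {x, y} \<in> A}"

definition conn :: "'a set set \<Rightarrow> ('a \<times> 'a) set" where
  "conn A = (adj A)\<^sup>*"

lemma conn_refl [simp]: "(x, x) \<in> conn A"
  by (simp add: conn_def)

lemma conn_sym: "(x, y) \<in> conn A \<Longrightarrow> (y, x) \<in> conn A"
  unfolding conn_def
  by (rule symD[OF sym_rtrancl]) (auto simp: sym_def adj_def insert_commute)

lemma conn_trans: "(x, y) \<in> conn A \<Longrightarrow> (y, z) \<in> conn A \<Longrightarrow> (x, z) \<in> conn A"
  unfolding conn_def by (rule rtrancl_trans)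

lemma conn_edge: "{x, y} \<in> A \<Longrightarrow> (x, y) \<in> conn A"
  by (auto simp: conn_def adj_def)

lemma conn_mono: "A \<subseteq> B \<Longrightarrow> conn A \<subseteq> conn B"
  unfolding conn_def by (rule rtrancl_mono) (auto simp: adj_def)

lemma conn_monoD: "(x, y) \<in> conn A \<Longrightarrow> A \<subseteq> B \<Longrightarrow> (x, y) \<in> conn B"
  using conn_mono by blast

lemma conn_subsetI:
  assumes "\<And>x y. {x, y} \<in> A \<Longrightarrow> (x, y) \<in> conn B"
  shows "conn A \<subseteq> conn B"
proof -
  have "adj A \<subseteq> (adj B)\<^sup>*"
    using assms by (auto simp: adj_def conn_def)
  then show ?thesis
    unfolding conn_def by (rule rtrancl_subset_rtrancl)
qed

lemma conn_closed:
  assumes "(x, y) \<in> conn A" "x \<in> V" "\<And>e. e \<in> A \<Longrightarrow> e \<subseteq> V"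
  shows "y \<in> V"
  using assms(1) unfolding conn_def
  by (induction rule: rtrancl_induct) (use assms(2,3) in \<open>auto simp: adj_def\<close>)

text \<open>A walk can be cut short so that it crosses the new edge at most once, in one of its two
  directions.\<close>

lemma conn_insertD:
  assumes "(x, y) \<in> conn (insert {u, v} A)"
  shows "(x, y) \<in> conn A \<or> (x, u) \<in> conn A \<and> (v, y) \<in> conn A \<or>
    (x, v) \<in> conn A \<and> (u, y) \<in> conn A"
  using assms unfolding conn_def[of "insert _ _"]
proof (induction rule: rtrancl_induct)
  case base
  then show ?case by simp
next
  case (step y z)
  from step.hyps(2) consider "y = u" "z = v" | "y = v" "z = u" | "(y, z) \<in> conn A"
    by (auto simp: adj_def doubleton_eq_iff conn_edge)
  then show ?case
    using step.IH by cases (blast intro: conn_trans conn_refl)+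
qed

text \<open>Acyclicity without mention of cycles: every edge is a bridge between its ends.\<close>

definition forest :: "'a set set \<Rightarrow> bool" where
  "forest A \<longleftrightarrow> (\<forall>x y. {x, y} \<in> A \<longrightarrow> (x, y) \<notin> conn (A - {{x, y}}))"

lemma forest_empty [simp]: "forest {}"
  by (simp add: forest_def)

lemma forest_subset:
  assumes "forest A" "B \<subseteq> A"
  shows "forest B"
  unfolding forest_def
proof (intro allI impI notI)
  fix x y
  assume "{x, y} \<in> B" "(x, y) \<in> conn (B - {{x, y}})"
  then have "{x, y} \<in> A" "(x, y) \<in> conn (A - {{x, y}})"
    using assms(2) conn_monoD[of x y "B - {{x, y}}" "A - {{x, y}}"] by auto
  then show False
    using assms(1) by (simp add: forest_def)
qed

text \<open>If an old edge \<open>{x, y}\<close> were on a cycle through the new edge, the rest of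
  that cycle together with \<open>{x, y}\<close> would join \<open>u\<close> and \<open>v\<close>
  within \<open>A\<close>.\<close>

lemma forest_insert:
  assumes "forest A" "(u, v) \<notin> conn A"
  shows "forest (insert {u, v} A)"
  unfolding forest_def
proof (intro allI impI notI)
  fix x y
  assume xy: "{x, y} \<in> insert {u, v} A" and c: "(x, y) \<in> conn (insert {u, v} A - {{x, y}})"
  show False
  proof (cases "{x, y} = {u, v}")
    case True
    then have "(x, y) \<in> conn A"
      by (intro conn_monoD[OF c]) auto
    then show False
      using True assms(2) by (metis conn_sym doubleton_eq_iff)
  next
    case False
    then have A: "{x, y} \<in> A" and "insert {u, v} A - {{x, y}} = insert {u, v} (A - {{x, y}})"
      using xy by auto
    then have "(x, u) \<in> conn (A - {{x, y}}) \<and> (v, y) \<in> conn (A - {{x, y}}) \<or>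
      (x, v) \<in> conn (A - {{x, y}}) \<and> (u, y) \<in> conn (A - {{x, y}})"
      using conn_insertD[of x y u v "A - {{x, y}}"] c assms(1) by (auto simp: forest_def)
    then have "(x, u) \<in> conn A \<and> (v, y) \<in> conn A \<or> (x, v) \<in> conn A \<and> (u, y) \<in> conn A"
      using conn_monoD[of _ _ "A - {{x, y}}" A] by blast
    then show False
      using conn_edge[OF A] assms(2) conn_sym conn_trans by metis
  qed
qed

text \<open>The edges whose removal separates \<open>u\<close> from \<open>v\<close> are those of
  the unique path between them in the forest.\<close>

lemma conn_bridges:
  assumes "finite A" "forest A" "\<And>e. e \<in> A \<Longrightarrow> card e = 2" "(u, v) \<in> conn A"
  shows "(u, v) \<in> conn {e \<in> A. (u, v) \<notin> conn (A - {e})}"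
proof -
  \<comment> \<open>An inclusion-minimal set joining \<open>u\<close> and \<open>v\<close> stands in
    for the path.\<close>
  obtain B where B: "B \<subseteq> A" "(u, v) \<in> conn B"
    and min: "\<And>C. C \<subset> B \<Longrightarrow> (u, v) \<notin> conn C"
  proof -
    let ?P = "\<lambda>B. B \<subseteq> A \<and> (u, v) \<in> conn B"
    have "?P A"
      using assms(4) by simp
    then obtain B where B: "?P B" and min: "\<And>C. ?P C \<Longrightarrow> card B \<le> card C"
      using exists_least_iff[of "\<lambda>n. \<exists>B. ?P B \<and> card B = n"] by (metis not_le)
    have "(u, v) \<notin> conn C" if "C \<subset> B" for C
      using min[of C] B that psubset_card_mono[OF finite_subset[OF _ assms(1)] that] by auto
    with B that show thesis by blast
  qed
  have "(u, v) \<notin> conn (A - {e})" if e: "e \<in> B" for e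
  proof
    \<comment> \<open>The two pieces of \<open>B\<close> on either side of \<open>e\<close>, joined
      by this detour, would connect the ends of \<open>e\<close> without \<open>e\<close>.\<close>
    assume c: "(u, v) \<in> conn (A - {e})"
    obtain x y where xy: "e = {x, y}"
      using assms(3) B(1) e card_2_iff by (metis subsetD)
    have "(u, v) \<notin> conn (B - {e})" "insert e (B - {e}) = B"
      using min e by auto
    then have "(u, x) \<in> conn (B - {e}) \<and> (y, v) \<in> conn (B - {e}) \<or>
      (u, y) \<in> conn (B - {e}) \<and> (x, v) \<in> conn (B - {e})"
      using conn_insertD[of u v x y "B - {e}"] B(2) xy by auto
    moreover have "B - {e} \<subseteq> A - {e}"
      using B(1) by auto
    ultimately have "(x, y) \<in> conn (A - {e})"
      using c conn_monoD conn_sym conn_trans by (metis (no_types, lifting))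
    then show False
      using assms(2) e B(1) xy by (auto simp: forest_def)
  qed
  then show ?thesis
    using B by (auto intro: conn_monoD[OF B(2)])
qed

text \<open>Deleting \<open>{x, y}\<close> separates \<open>u\<close> from \<open>v\<close> and
  leaves one end of it with each of them, so the edge \<open>{u, v}\<close> bridges the same
  gap.\<close>

lemma conn_exchange:
  assumes uv: "(u, v) \<in> conn A" and xy: "{x, y} \<in> A" and nc: "(u, v) \<notin> conn (A - {{x, y}})"
  shows "conn (insert {u, v} (A - {{x, y}})) = conn A"
proof
  show "conn (insert {u, v} (A - {{x, y}})) \<subseteq> conn A"
    by (rule conn_subsetI) (use uv conn_sym in \<open>auto simp: doubleton_eq_iff conn_edge\<close>)
  let ?B = "insert {u, v} (A - {{x, y}})"
  have "insert {x, y} (A - {{x, y}}) = A"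
    using xy by auto
  then have "(u, x) \<in> conn (A - {{x, y}}) \<and> (y, v) \<in> conn (A - {{x, y}}) \<or>
      (u, y) \<in> conn (A - {{x, y}}) \<and> (x, v) \<in> conn (A - {{x, y}})"
    using conn_insertD[of u v x y "A - {{x, y}}"] uv nc by auto
  then have "(u, x) \<in> conn ?B \<and> (y, v) \<in> conn ?B \<or> (u, y) \<in> conn ?B \<and> (x, v) \<in> conn ?B"
    using conn_monoD[of _ _ "A - {{x, y}}" ?B] by blast
  moreover have "(u, v) \<in> conn ?B"
    by (rule conn_edge) simp
  ultimately have "(x, y) \<in> conn ?B"
    using conn_sym conn_trans by metis
  then show "conn A \<subseteq> conn ?B"
    by (intro conn_subsetI)
      (metis conn_edge conn_sym doubleton_eq_iff insertCI Diff_iff empty_iff insert_iff)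
qed

section \<open>Components and the number of forest edges\<close>

definition classes :: "'a set \<Rightarrow> 'a set set \<Rightarrow> 'a set set" where
  "classes V A = (\<lambda>x. conn A `` {x}) ` V"

lemma class_eq_iff: "conn A `` {x} = conn A `` {y} \<longleftrightarrow> (x, y) \<in> conn A"
  by (auto simp: set_eq_iff intro: conn_sym conn_trans)

text \<open>Every old component lies in a new one; this map is onto but sends the components of
  \<open>u\<close> and \<open>v\<close> to the same one.\<close>

lemma card_classes_insert_less:
  assumes "finite V" "u \<in> V" "v \<in> V" "(u, v) \<notin> conn A"
  shows "card (classes V (insert {u, v} A)) < card (classes V A)"
proof -
  let ?B = "insert {u, v} A"
  let ?f = "\<lambda>X. conn ?B `` X"
  have f: "?f (conn A `` {x}) = conn ?B `` {x}" for x
    using conn_trans[of x _ ?B] conn_monoD[of x _ A ?B] by (auto simp: Image_iff)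
  have eq: "classes V ?B = ?f ` classes V A"
    by (simp add: classes_def image_image f)
  have fin: "finite (classes V A)"
    using assms(1) by (simp add: classes_def)
  have "\<not> inj_on ?f (classes V A)"
  proof
    assume inj: "inj_on ?f (classes V A)"
    have "?f (conn A `` {u}) = ?f (conn A `` {v})"
      unfolding f class_eq_iff by (rule conn_edge) simp
    then have "conn A `` {u} = conn A `` {v}"
      by (rule inj_onD[OF inj]) (use assms(2,3) in \<open>auto simp: classes_def\<close>)
    then show False
      using assms(4) by (simp add: class_eq_iff)
  qed
  then show ?thesis
    unfolding eq using fin by (metis card_image_le eq_card_imp_inj_on le_neq_implies_less)
qed

text \<open>Each edge of \<open>B\<close>, added in turn, joins two different components, so their
  number drops by at least one per edge. At least one component remains at the end, hence the strict
  bound.\<close>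

lemma card_forest_less:
  assumes "finite V" "V \<noteq> {}" "finite B" "forest (A \<union> B)" "A \<inter> B = {}"
    "\<And>e. e \<in> B \<Longrightarrow> e \<subseteq> V \<and> card e = 2"
  shows "card B < card (classes V A)"
proof -
  have "card (classes V (A \<union> B)) + card B \<le> card (classes V A)"
    using assms(3-6)
  proof (induction B rule: finite_induct)
    case empty
    then show ?case by simp
  next
    case (insert e B)
    obtain x y where xy: "e = {x, y}" "x \<in> V" "y \<in> V"
      using insert.prems(3)[of e] by (auto simp: card_2_iff)
    have "(A \<union> insert e B) - {e} = A \<union> B"
      using insert.hyps insert.prems(2) by auto
    then have "(x, y) \<notin> conn (A \<union> B)"
      using insert.prems(1) xy(1) by (auto simp: forest_def)
    then have "card (classes V (insert e (A \<union> B))) < card (classes V (A \<union> B))"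
      unfolding xy(1) using xy assms(1) by (intro card_classes_insert_less) auto
    moreover have "card (classes V (A \<union> B)) + card B \<le> card (classes V A)"
      using insert.prems by (intro insert.IH) (auto intro: forest_subset)
    ultimately show ?case
      using insert.hyps by simp
  qed
  moreover have "card (classes V (A \<union> B)) > 0"
    using assms(1,2) by (auto simp: classes_def card_gt_0_iff)
  ultimately show ?thesis by linarith
qed

section \<open>Tree packing\<close>

definition packing :: "'a set set \<Rightarrow> nat \<Rightarrow> (nat \<Rightarrow> 'a set set) \<Rightarrow> bool" where
  "packing E k F \<longleftrightarrow> (\<forall>i<k. F i \<subseteq> E \<and> forest (F i)) \<and>
     (\<forall>i<k. \<forall>j<k. \<forall>e. e \<in> F i \<longrightarrow> e \<in> F j \<longrightarrow> i = j)"

definition max_packing :: "'a set set \<Rightarrow> nat \<Rightarrow> (nat \<Rightarrow> 'a set set) \<Rightarrow> bool" where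
  "max_packing E k F \<longleftrightarrow> packing E k F \<and>
     (\<forall>F'. packing E k F' \<longrightarrow> (\<Sum>i<k. card (F' i)) \<le> (\<Sum>i<k. card (F i)))"

inductive swap :: "'a set set \<Rightarrow> nat \<Rightarrow> (nat \<Rightarrow> 'a set set) \<Rightarrow> (nat \<Rightarrow> 'a set set) \<Rightarrow> bool"
  for E k F where
  "i < k \<Longrightarrow> {u, v} \<in> E \<Longrightarrow> {u, v} \<notin> (\<Union>j<k. F j) \<Longrightarrow> e \<in> F i \<Longrightarrow> (u, v) \<notin> conn (F i - {e}) \<Longrightarrow>
    swap E k F (F(i := insert {u, v} (F i - {e})))"

lemma ex_max_packing:
  assumes "finite E"
  shows "\<exists>F. max_packing E k F"
proof -
  let ?t = "\<lambda>F. \<Sum>i<k. card (F i)"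
  have "packing E k (\<lambda>i. {})"
    by (simp add: packing_def)
  moreover have "?t F < Suc (k * card E)" if "packing E k F" for F
    using sum_bounded_above[of "{..<k}" "\<lambda>i. card (F i)" "card E"] that assms
    by (auto simp: packing_def card_mono less_Suc_eq_le)
  ultimately have "\<exists>F. packing E k F \<and> (\<forall>F'. packing E k F' \<longrightarrow> ?t F' \<le> ?t F)"
    using ex_has_greatest_nat[of "packing E k" _ ?t] by (metis less_imp_le)
  then show ?thesis
    by (simp add: max_packing_def)
qed

lemma swap_max_packing:
  assumes "finite E" "swap E k F F'" "max_packing E k F"
  shows "max_packing E k F'"
  using assms(2)
proof cases
  case (1 i u v e)
  have pack: "packing E k F"
    using assms(3) by (simp add: max_packing_def)
  have "forest (F i - {e})"
    using pack 1 by (auto simp: packing_def intro: forest_subset)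
  then have "forest (insert {u, v} (F i - {e}))"
    using 1 by (intro forest_insert)
  then have "packing E k F'"
    using pack 1 by (auto simp: packing_def)
  moreover have "(\<Sum>j<k. card (F' j)) = (\<Sum>j<k. card (F j))"
  proof (intro sum.cong refl)
    fix j
    have "finite (F i)"
      using pack 1 assms(1) by (auto simp: packing_def intro: finite_subset)
    then have "card (insert {u, v} (F i - {e})) = card (F i)"
      using 1 by (metis DiffE UN_I card.insert card_Suc_Diff1 finite_Diff lessThan_iff)
    then show "card (F' j) = card (F j)"
      using 1 by simp
  qed
  ultimately show ?thesis
    using assms(3) by (simp add: max_packing_def)
qed

lemma max_packing_conn:
  assumes "finite E" "max_packing E k F" "{u, v} \<in> E" "{u, v} \<notin> (\<Union>j<k. F j)" "i < k"
  shows "(u, v) \<in> conn (F i)"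
proof (rule ccontr)
  assume nc: "(u, v) \<notin> conn (F i)"
  let ?F = "F(i := insert {u, v} (F i))"
  have pack: "packing E k F"
    using assms(2) by (simp add: max_packing_def)
  have "packing E k ?F"
    using pack assms nc by (auto simp: packing_def intro: forest_insert)
  moreover have "(\<Sum>j<k. card (F j)) < (\<Sum>j<k. card (?F j))"
  proof (rule sum_strict_mono_ex1)
    have "finite (F i)"
      using pack assms by (auto simp: packing_def intro: finite_subset)
    then have "card (F i) < card (?F i)"
      using assms(4,5) by (simp add: card_insert_if)
    then show "\<exists>j\<in>{..<k}. card (F j) < card (?F j)" "\<forall>j\<in>{..<k}. card (F j) \<le> card (?F j)"
      using assms(5) by auto
  qed simp
  ultimately show False
    using assms(2) by (auto simp: max_packing_def not_le)
qed

definition boundary :: "'a set set \<Rightarrow> 'a set \<Rightarrow> 'a set set" where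
  "boundary E X = {e \<in> E. e \<inter> X \<noteq> {} \<and> \<not> e \<subseteq> X}"

lemma boundaryE:
  assumes "e \<in> boundary E X" "card e = 2"
  obtains x y where "e = {x, y}" "x \<in> X" "y \<notin> X"
proof -
  obtain a b where "e = {a, b}"
    using assms(2) by (meson card_2_iff)
  then show thesis
    using assms(1) that[of a b] that[of b a] by (auto simp: boundary_def)
qed

text \<open>The consequence of the theorem of Nash-Williams and Tutte in which the condition on
  partitions is replaced by a lower bound on cuts, proved directly by augmentation.\<close>

theorem tree_packing:
  assumes "finite V" "\<And>e. e \<in> E \<Longrightarrow> e \<subseteq> V \<and> card e = 2"
    and cuts: "\<And>X. X \<noteq> {} \<Longrightarrow> X \<subset> V \<Longrightarrow> 2 * k \<le> card (boundary E X)"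
  obtains F where "\<And>i. i < k \<Longrightarrow> F i \<subseteq> E"
    "\<And>i j. i < k \<Longrightarrow> j < k \<Longrightarrow> i \<noteq> j \<Longrightarrow> F i \<inter> F j = {}"
    "\<And>i. i < k \<Longrightarrow> V \<times> V \<subseteq> conn (F i)"
proof -
  have finE: "finite E"
    using assms(1,2) by (meson PowI finite_Pow_iff finite_subset subsetI)
  obtain F where max: "max_packing E k F"
    using ex_max_packing[OF finE] by blast
  \<comment> \<open>The edges that some packing in the swap orbit of \<open>F\<close> leaves unused. By maximality every \<open>F i \<inter> D\<close>
    has the same components as \<open>D\<close>, and all edges between these components are used. If there are
    \<open>p \<ge> 2\<close> components, there are at least \<open>k p\<close> such edges by the cut condition, but each forest
    \<open>F i\<close> has at most \<open>p - 1\<close> of them.\<close>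
  define D where "D = {e \<in> E. \<exists>F'. (swap E k)\<^sup>*\<^sup>* F F' \<and> e \<notin> (\<Union>j<k. F' j)}"
  have max': "max_packing E k F'" if "(swap E k)\<^sup>*\<^sup>* F F'" for F'
    using that by (induction rule: rtranclp_induct) (use max swap_max_packing[OF finE] in auto)
  have unused: "(u, v) \<in> conn (F' i \<inter> D)"
    if F': "(swap E k)\<^sup>*\<^sup>* F F'" and uv: "{u, v} \<in> E" "{u, v} \<notin> (\<Union>j<k. F' j)" and i: "i < k"
    for F' u v i
  proof -
    have pack: "packing E k F'"
      using max'[OF F'] by (simp add: max_packing_def)
    let ?B = "{e \<in> F' i. (u, v) \<notin> conn (F' i - {e})}"
    have sub: "F' i \<subseteq> E" "forest (F' i)"
      using pack i by (auto simp: packing_def)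
    have "(u, v) \<in> conn ?B"
      using sub finite_subset[OF sub(1) finE] max_packing_conn[OF finE max'[OF F'] uv i] assms(2)
      by (intro conn_bridges) auto
    moreover have "?B \<subseteq> F' i \<inter> D"
    proof
      fix e
      assume e: "e \<in> ?B"
      let ?F = "F'(i := insert {u, v} (F' i - {e}))"
      have "swap E k F' ?F"
        using e uv i by (auto intro: swap.intros)
      then have "(swap E k)\<^sup>*\<^sup>* F ?F"
        using F' by auto
      moreover have "e \<notin> (\<Union>j<k. ?F j)"
        using e uv i pack by (auto simp: packing_def split: if_splits)
      ultimately show "e \<in> F' i \<inter> D"
        using e sub unfolding D_def by blast
    qed
    ultimately show ?thesis
      by (rule conn_monoD)
  qed
  have inv: "conn (F' i \<inter> D) = conn (F i \<inter> D)" if "(swap E k)\<^sup>*\<^sup>* F F'" "i < k" for F' i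
    using that(1)
  proof (induction rule: rtranclp_induct)
    case base
    then show ?case by simp
  next
    case (step F1 F2)
    from step.hyps(2) show ?case
    proof cases
      case (1 j u v e)
      have pack: "packing E k F1"
        using max'[OF step.hyps(1)] by (simp add: max_packing_def)
      have "e \<in> E"
        using 1 pack by (auto simp: packing_def)
      then obtain x y where xy: "e = {x, y}"
        using assms(2) by (meson card_2_iff)
      have "e \<notin> (\<Union>j<k. F2 j)"
        using 1 pack by (auto simp: packing_def split: if_splits)
      moreover have "(swap E k)\<^sup>*\<^sup>* F F2"
        using step.hyps by auto
      ultimately have eD: "e \<in> D"
        using \<open>e \<in> E\<close> unfolding D_def by blast
      have "{u, v} \<in> D"
        using 1 step.hyps(1) by (auto simp: D_def)
      then have "F2 j \<inter> D = insert {u, v} (F1 j \<inter> D - {{x, y}})"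
        using 1 xy by auto
      moreover have "conn \<dots> = conn (F1 j \<inter> D)"
      proof (rule conn_exchange)
        show "(u, v) \<in> conn (F1 j \<inter> D)"
          using unused[OF step.hyps(1)] 1 by blast
        show "{x, y} \<in> F1 j \<inter> D"
          using 1 xy eD by auto
        show "(u, v) \<notin> conn (F1 j \<inter> D - {{x, y}})"
          using 1 xy conn_monoD[of u v "F1 j \<inter> D - {{x, y}}" "F1 j - {{x, y}}"] by auto
      qed
      ultimately show ?thesis
        using step.IH 1 by (cases "i = j") auto
    qed
  qed
  have connD: "conn (F i \<inter> D) = conn D" if i: "i < k" for i
  proof
    show "conn (F i \<inter> D) \<subseteq> conn D"
      by (rule conn_mono) auto
    show "conn D \<subseteq> conn (F i \<inter> D)"
    proof (rule conn_subsetI)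
      fix x y
      assume "{x, y} \<in> D"
      then obtain F' where "(swap E k)\<^sup>*\<^sup>* F F'" "{x, y} \<in> E" "{x, y} \<notin> (\<Union>j<k. F' j)"
        by (auto simp: D_def)
      then show "(x, y) \<in> conn (F i \<inter> D)"
        using unused[of F' x y i] inv[of F' i] i by simp
    qed
  qed
  have pack: "packing E k F"
    using max by (simp add: max_packing_def)
  let ?P = "classes V D"
  let ?C = "\<Union>i<k. F i - D"
  have DV: "conn D `` {x} \<subseteq> V" if "x \<in> V" for x
    using that assms(2) conn_closed[of x _ D V] by (auto simp: D_def)
  have "V \<times> V \<subseteq> conn D" if "k > 0"
  proof (rule ccontr)
    assume nc: "\<not> V \<times> V \<subseteq> conn D"
    then have "V \<noteq> {}" by auto
    have finP: "finite ?P"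
      using assms(1) by (simp add: classes_def)
    have "card ?P > 0"
      using \<open>V \<noteq> {}\<close> finP by (auto simp: classes_def card_gt_0_iff)
    have finC: "finite ?C"
      using pack finE by (auto simp: packing_def intro: finite_subset)
    have "card (F i - D) \<le> card ?P - 1" if i: "i < k" for i
    proof -
      have "card (F i - D) < card (classes V (F i \<inter> D))"
      proof (rule card_forest_less)
        show "finite (F i - D)"
          using pack finE i by (auto simp: packing_def intro: finite_subset)
        show "forest (F i \<inter> D \<union> (F i - D))"
          using pack i by (auto simp: packing_def intro: forest_subset)
        show "e \<subseteq> V \<and> card e = 2" if "e \<in> F i - D" for e
          using that pack i assms(2) by (auto simp: packing_def)
      qed (use assms(1) \<open>V \<noteq> {}\<close> in auto)
      then show ?thesis
        by (simp add: classes_def connD i)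
    qed
    then have "card ?C \<le> k * (card ?P - 1)"
      using card_UN_le[of "{..<k}" "\<lambda>i. F i - D"]
        sum_bounded_above[of "{..<k}" "\<lambda>i. card (F i - D)" "card ?P - 1"] by simp
    moreover have "2 * k * card ?P \<le> 2 * card ?C"
    proof -
      \<comment> \<open>Edges of \<open>D\<close> stay within one component, and an edge of
        \<open>E\<close> outside \<open>D\<close> is used by every packing of the orbit, in
        particular by \<open>F\<close>.\<close>
      have sub: "boundary E X \<subseteq> ?C" if "X \<in> ?P" for X
      proof
        fix e
        assume e: "e \<in> boundary E X"
        have "e \<notin> D"
        proof
          assume "e \<in> D"
          obtain x y where "e = {x, y}" "x \<in> X" "y \<notin> X"
            using e assms(2) by (metis (no_types, lifting) boundaryE boundary_def mem_Collect_eq)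
          then show False
            using \<open>e \<in> D\<close> that conn_trans[of _ x D y] by (auto simp: classes_def conn_edge)
        qed
        moreover have "e \<in> (\<Union>i<k. F i)"
          using \<open>e \<notin> D\<close> e by (auto simp: D_def boundary_def)
        ultimately show "e \<in> ?C" by auto
      qed
      have "2 * k \<le> card (boundary E X)" if X: "X \<in> ?P" for X
      proof (rule cuts)
        show "X \<noteq> {}"
          using X by (auto simp: classes_def) (metis Image_singleton_iff conn_refl empty_iff)
        have "X \<noteq> V"
        proof
          assume "X = V"
          then obtain x where "V = conn D `` {x}"
            using X by (auto simp: classes_def)
          then show False
            using nc by (auto intro: conn_sym conn_trans)
        qed
        then show "X \<subset> V"
          using X DV by (auto simp: classes_def)
      qed
      \<comment> \<open>Double counting of pairs of a component and an edge leaving it: at least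
        \<open>2 * k\<close> edges for each component, at most two components for each edge.\<close>
      then have "card ?P * (2 * k) \<le> (\<Sum>X\<in>?P. card (boundary E X))"
        using sum_bounded_below[of ?P "2 * k" "\<lambda>X. card (boundary E X)"] by simp
      also have "\<dots> = (\<Sum>X\<in>?P. \<Sum>e\<in>?C. if e \<in> boundary E X then 1 else 0)"
        using sub finC by (intro sum.cong refl) (simp add: sum.If_cases Int_absorb1)
      also have "\<dots> = (\<Sum>e\<in>?C. \<Sum>X\<in>?P. if e \<in> boundary E X then 1 else 0)"
        by (rule sum.swap)
      also have "\<dots> = (\<Sum>e\<in>?C. card {X \<in> ?P. e \<in> boundary E X})"
        using finP by (intro sum.cong refl) (simp add: sum.If_cases Collect_conj_eq)
      also have "\<dots> \<le> (\<Sum>e\<in>?C. 2)"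
      proof (rule sum_mono)
        fix e
        assume "e \<in> ?C"
        then have "e \<in> E"
          using pack by (auto simp: packing_def)
        then obtain x y where xy: "e = {x, y}"
          using assms(2) by (meson card_2_iff)
        have "X \<in> {conn D `` {x}, conn D `` {y}}" if X: "X \<in> ?P" "e \<in> boundary E X" for X
        proof -
          obtain z where "X = conn D `` {z}"
            using X by (auto simp: classes_def)
          moreover have "x \<in> X \<or> y \<in> X"
            using X xy by (auto simp: boundary_def)
          ultimately show ?thesis
            using class_eq_iff[of D z] by auto
        qed
        then have "card {X \<in> ?P. e \<in> boundary E X} \<le> card {conn D `` {x}, conn D `` {y}}"
          by (intro card_mono) auto
        also have "\<dots> \<le> 2"
          by (simp add: card_insert_if)
        finally show "card {X \<in> ?P. e \<in> boundary E X} \<le> 2" .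
      qed
      finally show ?thesis
        by (simp add: mult.commute)
    qed
    ultimately have "k * card ?P \<le> k * (card ?P - 1)" by linarith
    then show False
      using \<open>card ?P > 0\<close> \<open>k > 0\<close> by simp
  qed
  then have "V \<times> V \<subseteq> conn (F i)" if "i < k" for i
    using that connD[OF that] conn_mono[of "F i \<inter> D" "F i"] by auto
  with pack show thesis
    by (intro that[of F]) (auto simp: packing_def)
qed

section \<open>Edge cuts and line graphs\<close>

lemma successively_conn:
  assumes "successively (\<lambda>x y. {x, y} \<in> A) p" "p \<noteq> []"
  shows "(hd p, last p) \<in> conn A"
  using assms
proof (induction p rule: induct_list012)
  case (3 x y p)
  then show ?case
    using conn_trans[OF conn_edge[of x y A]] by simp
qed auto

lemma conn_path:
  assumes "\<And>e. e \<in> edges G \<Longrightarrow> e \<subseteq> verts G" "(u, v) \<in> conn (edges G)" "v \<in> verts G"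
  shows "\<exists>p. path G u p v"
  using assms(2) unfolding conn_def
proof (induction rule: converse_rtrancl_induct)
  case base
  show ?case
    using assms(3) by (intro exI[of _ "[v]"]) (auto simp: path_def)
next
  case (step x y)
  then obtain p where p: "path G y p v"
    by blast
  have xy: "{x, y} \<in> edges G"
    using step.hyps(1) by (simp add: adj_def)
  show ?case
  \<comment> \<open>Vertices on a path are distinct, so if \<open>x\<close> already occurs on
    \<open>p\<close>, the part of \<open>p\<close> from \<open>x\<close> on is taken instead of a
    longer list.\<close>
  proof (cases "x \<in> set p")
    case True
    then obtain as bs where "p = as @ x # bs"
      by (meson split_list)
    then have "path G x (x # bs) v"
      using p by (auto simp: path_def successively_append_iff)
    then show ?thesis ..
  next
    case False
    then have "path G x (x # p) v"
      using p xy assms(1)[OF xy] by (cases p) (auto simp: path_def)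
    then show ?thesis ..
  qed
qed

lemma connected_graph_iff_conn:
  assumes "\<And>e. e \<in> edges G \<Longrightarrow> e \<subseteq> verts G"
  shows "connected_graph G \<longleftrightarrow> verts G \<noteq> {} \<and> verts G \<times> verts G \<subseteq> conn (edges G)"
proof
  assume "connected_graph G"
  then show "verts G \<noteq> {} \<and> verts G \<times> verts G \<subseteq> conn (edges G)"
    using successively_conn[of "edges G"] by (fastforce simp: connected_graph_def path_def)
next
  assume "verts G \<noteq> {} \<and> verts G \<times> verts G \<subseteq> conn (edges G)"
  then show "connected_graph G"
    using conn_path[OF assms] by (auto simp: connected_graph_def)
qed

lemma simple_graph_edge:
  assumes "simple_graph G" "e \<in> edges G"
  shows "e \<subseteq> verts G" "card e = 2"
  using assms by (auto simp: simple_graph_def)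

lemma finite_edges:
  assumes "simple_graph G"
  shows "finite (edges G)"
  using assms by (auto simp: simple_graph_def intro: finite_subset[of _ "Pow (verts G)"])

lemma simple_graph_line_graph:
  assumes "simple_graph G"
  shows "simple_graph (line_graph G)"
  unfolding simple_graph_def
proof (intro conjI ballI)
  show "finite (verts (line_graph G))"
    using finite_edges[OF assms] by (simp add: line_graph_def)
next
  fix g
  assume "g \<in> edges (line_graph G)"
  then obtain e f where "g = {e, f}" "e \<in> edges G" "f \<in> edges G" "e \<noteq> f"
    by (auto simp: line_graph_def)
  then show "g \<subseteq> verts (line_graph G)" "card g = 2"
    by (simp_all add: line_graph_def)
qed

lemma simple_graph_del_verts: "simple_graph G \<Longrightarrow> simple_graph (del_verts G S)"
  by (auto simp: simple_graph_def del_verts_def)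

lemma simple_graph_del_edges: "simple_graph G \<Longrightarrow> simple_graph (del_edges G S)"
  by (auto simp: simple_graph_def del_edges_def)

lemma connected_graph_iff_boundary:
  assumes "simple_graph G" "verts G \<noteq> {}"
  shows "connected_graph G \<longleftrightarrow> (\<forall>X. X \<noteq> {} \<longrightarrow> X \<subset> verts G \<longrightarrow> boundary (edges G) X \<noteq> {})"
proof -
  note iff = connected_graph_iff_conn[OF simple_graph_edge(1)[OF assms(1)]]
  show ?thesis
  proof
    assume G: "connected_graph G"
    show "\<forall>X. X \<noteq> {} \<longrightarrow> X \<subset> verts G \<longrightarrow> boundary (edges G) X \<noteq> {}"
    proof (intro allI impI notI)
      fix X
      assume X: "X \<noteq> {}" "X \<subset> verts G" "boundary (edges G) X = {}"
      then obtain x y where xy: "x \<in> X" "y \<in> verts G" "y \<notin> X"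
        by blast
      have "(x, y) \<in> conn (edges G)"
        using G xy X by (auto simp: iff)
      then have "y \<in> X"
        unfolding conn_def
      proof (induction rule: rtrancl_induct)
        case (step y z)
        then show ?case
          using X(3) by (auto simp: adj_def boundary_def)
      qed (fact xy)
      with xy show False by simp
    qed
  next
    assume cuts: "\<forall>X. X \<noteq> {} \<longrightarrow> X \<subset> verts G \<longrightarrow> boundary (edges G) X \<noteq> {}"
    have "(x, y) \<in> conn (edges G)" if xy: "x \<in> verts G" "y \<in> verts G" for x y
    proof (rule ccontr)
      assume nc: "(x, y) \<notin> conn (edges G)"
      \<comment> \<open>The component of \<open>x\<close>: an edge leaving it would lead to a
        further vertex reachable from \<open>x\<close>.\<close>
      let ?X = "conn (edges G) `` {x} \<inter> verts G"
      have "x \<in> ?X" "?X \<subset> verts G"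
        using xy nc by auto
      then obtain e where e: "e \<in> boundary (edges G) ?X"
        using cuts[rule_format, of ?X] by blast
      then have "e \<in> edges G"
        by (simp add: boundary_def)
      then obtain a b where ab: "e = {a, b}" "a \<in> ?X" "b \<notin> ?X"
        by (rule boundaryE[OF e simple_graph_edge(2)[OF assms(1)]])
      moreover have "b \<in> verts G" "(a, b) \<in> conn (edges G)"
        using \<open>e \<in> edges G\<close> ab(1) simple_graph_edge(1)[OF assms(1)] by (auto simp: conn_edge)
      ultimately show False
        using conn_trans[of x a _ b] by auto
    qed
    then show "connected_graph G"
      using assms(2) by (auto simp: iff)
  qed
qed

section \<open>Cuts of a graph and vertex cuts of its line graph\<close>

lemma k_connectedD:
  assumes "k_connected n G" "S \<subseteq> verts G"
    "\<not> connected_graph (del_verts G S) \<or> card (verts G - S) \<le> 1"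
  shows "n \<le> card S"
proof -
  have "vertex_connectivity G \<le> card S"
    unfolding vertex_connectivity_def by (rule Least_le) (use assms(2,3) in blast)
  then show ?thesis
    using assms(1) by (simp add: k_connected_def)
qed

text \<open>Once the cut edges are gone, no edge inside \<open>X\<close> meets an edge outside
  \<open>X\<close>, so the cut separates them as vertices of the line graph; \<open>e\<close> and
  \<open>f\<close> show that neither side is empty.\<close>

lemma k_connected_line_graph_boundary:
  assumes "simple_graph G" "k_connected n (line_graph G)"
    and "e \<in> edges G" "e \<subseteq> X" "f \<in> edges G" "f \<inter> X = {}"
  shows "n \<le> card (boundary (edges G) X)"
proof (rule k_connectedD[OF assms(2)])
  let ?H = "del_verts (line_graph G) (boundary (edges G) X)"
  let ?Y = "{e \<in> edges G. e \<subseteq> X}"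
  show "boundary (edges G) X \<subseteq> verts (line_graph G)"
    by (auto simp: boundary_def line_graph_def)
  have "f \<noteq> {}"
    using simple_graph_edge(2)[OF assms(1,5)] by auto
  then have Y: "e \<in> ?Y" "f \<notin> ?Y" "f \<in> verts ?H" "?Y \<subseteq> verts ?H"
    using assms(3-6) by (auto simp: del_verts_def line_graph_def boundary_def)
  have empty: "boundary (edges ?H) ?Y = {}"
  proof (rule equals0I)
    fix g
    assume g: "g \<in> boundary (edges ?H) ?Y"
    have "g \<in> edges ?H"
      using g by (simp add: boundary_def)
    then have "card g = 2"
      using simple_graph_edge(2) simple_graph_del_verts simple_graph_line_graph assms(1) by blast
    then obtain a b where ab: "g = {a, b}" "a \<in> ?Y" "b \<notin> ?Y"
      by (rule boundaryE[OF g])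
    moreover have "b \<in> edges G" "b \<notin> boundary (edges G) X" "a \<inter> b \<noteq> {}"
      using \<open>g \<in> edges ?H\<close> ab(1) by (auto simp: del_verts_def line_graph_def doubleton_eq_iff)
    ultimately show False
      by (auto simp: boundary_def)
  qed
  have H: "simple_graph ?H"
    by (intro simple_graph_del_verts simple_graph_line_graph assms(1))
  have ne: "?Y \<noteq> {}" "?Y \<subset> verts ?H" "verts ?H \<noteq> {}"
    using Y by auto
  have "\<not> connected_graph ?H"
    using connected_graph_iff_boundary[OF H ne(3), THEN iffD1, rule_format, OF _ ne(1,2)]
    by (rule contrapos_pn[OF empty])
  then show "\<not> connected_graph ?H \<or> card (verts (line_graph G) - boundary (edges G) X) \<le> 1" ..
qed

lemma boundary_compl:
  assumes "\<And>e. e \<in> E \<Longrightarrow> e \<subseteq> V"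
  shows "boundary E (V - X) = boundary E X"
  using assms by (auto simp: boundary_def)

text \<open>Since no edge lies within \<open>X\<close>, all edges at \<open>v\<close> leave
  it.\<close>

lemma min_degree_le_card_boundary:
  assumes "simple_graph G" "v \<in> X" "v \<in> verts G" "\<And>e. e \<in> edges G \<Longrightarrow> \<not> e \<subseteq> X"
  shows "min_degree G \<le> card (boundary (edges G) X)"
proof -
  have "min_degree G \<le> degree G v"
    using assms(1,3) by (simp add: min_degree_def simple_graph_def)
  also have "\<dots> \<le> card (boundary (edges G) X)"
    unfolding degree_def
  proof (rule card_mono)
    show "finite (boundary (edges G) X)"
      using finite_edges[OF assms(1)] by (simp add: boundary_def)
  qed (use assms(2,4) in \<open>auto simp: boundary_def\<close>)
  finally show ?thesis .
qed

text \<open>Under the degree bound, either both sides of the cut carry an edge or the cut contains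
  the star of a vertex. If \<open>G\<close> is not super edge-connected, a minimum cut that isolates
  no vertex has edges on both sides, and every other cut is at least as large.\<close>

lemma card_boundary_ge:
  assumes G: "simple_graph G" and L: "k_connected n (line_graph G)"
    and or: "connected_graph G \<and> \<not> super_edge_connected G \<or> n \<le> min_degree G"
    and X: "X \<noteq> {}" "X \<subset> verts G"
  shows "n \<le> card (boundary (edges G) X)"
  using or
proof
  assume "n \<le> min_degree G"
  show ?thesis
  proof (cases "\<exists>e\<in>edges G. \<exists>f\<in>edges G. e \<subseteq> X \<and> f \<inter> X = {}")
    case True
    then show ?thesis
      using k_connected_line_graph_boundary[OF G L] by blast
  next
    case False
    have "min_degree G \<le> card (boundary (edges G) X)"
    proof (cases "\<exists>e\<in>edges G. e \<subseteq> X")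
      case False
      moreover obtain v where "v \<in> X" "v \<in> verts G"
        using X by blast
      ultimately show ?thesis
        by (intro min_degree_le_card_boundary[OF G]) auto
    next
      case True
      \<comment> \<open>As \<open>X\<close> contains an edge, no edge is disjoint from
        \<open>X\<close>; so the complement contains none, and its cut is the same.\<close>
      obtain v where "v \<in> verts G - X"
        using X by blast
      then have "min_degree G \<le> card (boundary (edges G) (verts G - X))"
        using True \<open>\<not> (\<exists>e\<in>edges G. \<exists>f\<in>edges G. e \<subseteq> X \<and> f \<inter> X = {})\<close>
        by (intro min_degree_le_card_boundary[OF G]) auto
      then show ?thesis
        using simple_graph_edge(1)[OF G] by (simp add: boundary_compl)
    qed
    then show ?thesis
      using \<open>n \<le> min_degree G\<close> by simp
  qed
next
  assume "connected_graph G \<and> \<not> super_edge_connected G"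
  then obtain F where F: "minimum_edge_cut G F" "\<And>v. v \<in> verts G \<Longrightarrow> degree (del_edges G F) v \<noteq> 0"
    by (auto simp: super_edge_connected_def)
  let ?H = "del_edges G F"
  have sub: "F \<subseteq> edges G" and "\<not> connected_graph ?H"
    using F(1) by (auto simp: minimum_edge_cut_def edge_cut_def)
  have H: "verts ?H = verts G" "edges ?H = edges G - F"
    by (simp_all add: del_edges_def)
  have "verts G \<noteq> {}"
    using X by auto
  then obtain Y where Y: "Y \<noteq> {}" "Y \<subset> verts G" "boundary (edges G - F) Y = {}"
    using \<open>\<not> connected_graph ?H\<close> connected_graph_iff_boundary[OF simple_graph_del_edges[OF G], of F]
    by (auto simp: H)
  have edge: "\<exists>e\<in>edges G - F. v \<in> e" if "v \<in> verts G" for v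
    using F(2)[OF that] by (auto simp: degree_def H card_eq_0_iff)
  obtain y z where yz: "y \<in> Y" "z \<in> verts G - Y"
    using Y by blast
  obtain e where e: "e \<in> edges G - F" "y \<in> e"
    using edge yz Y by blast
  obtain f where f: "f \<in> edges G - F" "z \<in> f"
    using edge yz by blast
  \<comment> \<open>No edge outside \<open>F\<close> leaves \<open>Y\<close>, so \<open>e\<close>,
    which contains \<open>y\<close>, lies in \<open>Y\<close>, and \<open>f\<close>, which contains
    \<open>z\<close>, avoids \<open>Y\<close>.\<close>
  have "n \<le> card (boundary (edges G) Y)"
    by (rule k_connected_line_graph_boundary[OF G L, of e _ f])
      (use e f yz Y(3) in \<open>auto simp: boundary_def\<close>)
  also have "\<dots> \<le> card F"
    using Y(3) finite_subset[OF sub finite_edges[OF G]] by (intro card_mono) (auto simp: boundary_def)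
  \<comment> \<open>The boundary of \<open>X\<close> is itself an edge cut, hence no smaller than
    the minimum cut \<open>F\<close>.\<close>
  also have "\<dots> \<le> card (boundary (edges G) X)"
  proof -
    have "boundary (edges (del_edges G (boundary (edges G) X))) X = {}"
      by (auto simp: del_edges_def boundary_def)
    then have "\<not> connected_graph (del_edges G (boundary (edges G) X))"
      using connected_graph_iff_boundary[OF simple_graph_del_edges[OF G], of "boundary (edges G) X"] X
      by (auto simp: del_edges_def)
    then have "edge_cut G (boundary (edges G) X)"
      by (auto simp: edge_cut_def boundary_def)
    then show ?thesis
      using F(1) by (simp add: minimum_edge_cut_def)
  qed
  finally show ?thesis .
qed

section \<open>Completely independent spanning trees\<close>

text \<open>Following parents decreases \<open>rank\<close> and so ends in \<open>\<rho>\<close>,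
  which gives connectedness. A vertex of greatest rank on a cycle would have its parent as both of
  its neighbours, which excludes cycles.\<close>

lemma tree_of_parent:
  fixes rank :: "'a \<Rightarrow> nat"
  assumes "finite V" "\<rho> \<in> V"
    and par: "\<And>v. v \<in> V \<Longrightarrow> v \<noteq> \<rho> \<Longrightarrow> par v \<in> V \<and> rank (par v) < rank v"
  shows "tree (Graph V ((\<lambda>v. {v, par v}) ` (V - {\<rho>})))"
    (is "tree ?T")
proof -
  have simple: "simple_graph ?T"
    using assms(1) par by (auto simp: simple_graph_def card_2_iff) (metis less_irrefl)
  have "(v, \<rho>) \<in> conn (edges ?T)" if "v \<in> V" for v
    using that
  proof (induction "rank v" arbitrary: v rule: less_induct)
    case less
    show ?case
    proof (cases "v = \<rho>")
      case False
      then have "(v, par v) \<in> conn (edges ?T)"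
        using less.prems by (intro conn_edge) auto
      moreover have "(par v, \<rho>) \<in> conn (edges ?T)"
        using False less par by blast
      ultimately show ?thesis
        by (rule conn_trans)
    qed simp
  qed
  then have "V \<times> V \<subseteq> conn (edges ?T)"
    by (auto intro: conn_trans conn_sym)
  then have "connected_graph ?T"
    using connected_graph_iff_conn[OF simple_graph_edge(1)[OF simple]] assms(2) by auto
  moreover have "\<not> cycle ?T c" for c
  proof
    assume c: "cycle ?T c"
    define n where "n = length c"
    have n: "3 \<le> n" and dist: "distinct c" and setc: "set c \<subseteq> V"
      and edge: "\<And>i. Suc i < n \<Longrightarrow> {c ! i, c ! Suc i} \<in> edges ?T"
      and closing: "{c ! (n - 1), c ! 0} \<in> edges ?T"
      using c by (auto simp: cycle_def path_def n_def successively_conv_nth last_conv_nth hd_conv_nth)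
    have nbr: "y = par x" if "{x, y} \<in> edges ?T" "rank y \<le> rank x" for x y
      using that par by (auto simp: doubleton_eq_iff) (metis leD)
    have "finite (rank ` set c)" "rank ` set c \<noteq> {}"
      using n by (auto simp: n_def)
    then obtain x where "x \<in> set c" and max: "\<And>y. y \<in> set c \<Longrightarrow> rank y \<le> rank x"
      using Max_in[of "rank ` set c"] Max_ge[of "rank ` set c"] by (metis (no_types, lifting) image_iff)
    then obtain m where m: "m < n" "x = c ! m"
      by (auto simp: in_set_conv_nth n_def)
    \<comment> \<open>Indices of the two neighbours of \<open>x\<close> on the cycle, with
      wrap-around at the ends; they differ because the cycle has at least three vertices.\<close>
    define a where "a = (if Suc m < n then Suc m else 0)"
    define b where "b = (if m = 0 then n - 1 else m - 1)"
    have lt: "a < n" "b < n" "a \<noteq> b"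
      using m n by (auto simp: a_def b_def)
    have "{x, c ! a} \<in> edges ?T"
    proof (cases "Suc m < n")
      case True
      then show ?thesis
        using edge[of m] by (simp add: a_def m)
    next
      case False
      then have "m = n - 1"
        using m by simp
      then show ?thesis
        using closing False by (simp add: a_def m)
    qed
    moreover have "{x, c ! b} \<in> edges ?T"
      using edge[of "m - 1"] closing m by (cases m) (auto simp: b_def insert_commute)
    ultimately have "c ! a = c ! b"
      using nbr[of x "c ! a"] nbr[of x "c ! b"] max[of "c ! a"] max[of "c ! b"] lt
      by (simp add: n_def)
    then show False
      using lt dist by (simp add: nth_eq_iff_index_eq n_def)
  qed
  ultimately show ?thesis
    using simple by (simp add: tree_def)
qed

lemma path_inner_vertex:
  assumes "path G u p v" "x \<in> set p" "x \<noteq> u" "x \<noteq> v"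
  obtains y z where "y \<noteq> z" "{x, y} \<in> edges G" "{x, z} \<in> edges G"
proof -
  obtain m where m: "m < length p" "x = p ! m"
    using assms(2) by (auto simp: in_set_conv_nth)
  have "m \<noteq> 0"
    using assms m by (metis hd_conv_nth path_def)
  have "m \<noteq> length p - 1"
    using assms m by (auto simp: path_def last_conv_nth)
  then have lt: "Suc m < length p"
    using m by simp
  have edge: "\<And>i. Suc i < length p \<Longrightarrow> {p ! i, p ! Suc i} \<in> edges G" and dist: "distinct p"
    using assms(1) by (auto simp: path_def successively_conv_nth)
  show thesis
  proof (rule that)
    show "p ! Suc m \<noteq> p ! (m - 1)"
      using lt dist by (simp add: nth_eq_iff_index_eq)
    show "{x, p ! Suc m} \<in> edges G"
      using edge[OF lt] m by simp
    show "{x, p ! (m - 1)} \<in> edges G"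
      using edge[of "m - 1"] m \<open>m \<noteq> 0\<close> by (simp add: insert_commute)
  qed
qed

text \<open>\<open>I i\<close> contains every vertex with two neighbours in \<open>T i\<close>,
  hence all inner vertices of paths in \<open>T i\<close>; so paths in different trees can meet only
  in their ends.\<close>

lemma completely_independent_spanning_treesI:
  assumes "\<And>i. i < k \<Longrightarrow> spanning_tree H (T i)"
    and edges: "\<And>i j. i < k \<Longrightarrow> j < k \<Longrightarrow> i \<noteq> j \<Longrightarrow> edges (T i) \<inter> edges (T j) = {}"
    and I: "\<And>i j. i < k \<Longrightarrow> j < k \<Longrightarrow> i \<noteq> j \<Longrightarrow> I i \<inter> I j = {}"
    and leaf: "\<And>i x y z. i < k \<Longrightarrow> x \<notin> I i \<Longrightarrow> {x, y} \<in> edges (T i) \<Longrightarrow> {x, z} \<in> edges (T i) \<Longrightarrow> y = z"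
  shows "completely_independent_spanning_trees H k T"
  unfolding completely_independent_spanning_trees_def
proof (intro conjI allI impI ballI)
  fix i
  assume "i < k"
  then show "spanning_tree H (T i)" by fact
next
  fix u v i j p q
  assume ij: "i < k" "j < k" "i \<noteq> j" and pq: "path (T i) u p v \<and> path (T j) u q v"
  have "path_edges p \<subseteq> edges (T i)" "path_edges q \<subseteq> edges (T j)"
    using pq by (auto simp: path_edges_def path_def successively_conv_nth)
  then show "path_edges p \<inter> path_edges q = {}"
    using edges[OF ij] by blast
  have "x \<in> I i" if "x \<in> set p" "x \<noteq> u" "x \<noteq> v" for x
    using path_inner_vertex[of "T i" u p v x] pq that leaf[OF ij(1)] by metis
  moreover have "x \<in> I j" if "x \<in> set q" "x \<noteq> u" "x \<noteq> v" for x
    using path_inner_vertex[of "T j" u q v x] pq that leaf[OF ij(2)] by metis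
  ultimately show "set p \<inter> set q \<subseteq> {u, v}"
    using I[OF ij] by blast
qed

section \<open>Construction of the trees in the line graph\<close>

lemma ex_parent:
  assumes "V \<times> V \<subseteq> conn A" "r \<in> V" "\<And>e. e \<in> A \<Longrightarrow> e \<subseteq> V"
  shows "\<exists>q (d :: 'a \<Rightarrow> nat). \<forall>v\<in>V - {r}. q v \<in> V \<and> {v, q v} \<in> A \<and> d (q v) < d v"
proof -
  \<comment> \<open>The distance from \<open>r\<close>; the parent of \<open>v\<close> will be its
    predecessor on a shortest walk from \<open>r\<close>.\<close>
  define d where "d v = (LEAST n. (r, v) \<in> adj A ^^ n)" for v
  have "\<exists>w. w \<in> V \<and> {v, w} \<in> A \<and> d w < d v" if v: "v \<in> V - {r}" for v
  proof -
    have "(r, v) \<in> (adj A)\<^sup>*"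
      using assms(1,2) v by (auto simp: conn_def)
    then have dv: "(r, v) \<in> adj A ^^ d v"
      unfolding d_def by (metis LeastI_ex rtrancl_power)
    then obtain m where m: "d v = Suc m"
      using v by (cases "d v") auto
    then obtain w where w: "(r, w) \<in> adj A ^^ m" "(w, v) \<in> adj A"
      using dv by auto
    then have "d w \<le> m"
      unfolding d_def by (intro Least_le)
    then show ?thesis
      using w(2) m assms(3) by (auto simp: adj_def insert_commute intro!: exI[of _ w])
  qed
  then show ?thesis by metis
qed

text \<open>The parent of \<open>f\<close> in the \<open>i\<close>-th tree is the edge that leads
  from a chosen end of \<open>f\<close>, if that end is not the root, one step towards the root
  inside \<open>F i\<close>. The choice of ends makes the trees edge-disjoint.\<close>

lemma line_graph_cist:
  assumes G: "simple_graph G" and E: "edges G \<noteq> {}"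
    and F: "\<And>i. i < k \<Longrightarrow> F i \<subseteq> edges G"
    and disj: "\<And>i j. i < k \<Longrightarrow> j < k \<Longrightarrow> i \<noteq> j \<Longrightarrow> F i \<inter> F j = {}"
    and conn: "\<And>i. i < k \<Longrightarrow> verts G \<times> verts G \<subseteq> conn (F i)"
  shows "\<exists>T. completely_independent_spanning_trees (line_graph G) k T"
proof -
  let ?V = "verts G" and ?E = "edges G"
  obtain e where "e \<in> ?E"
    using E by blast
  then obtain r r' where r: "r \<in> ?V" "r' \<in> ?V" "r \<noteq> r'"
    using simple_graph_edge[OF G] by (auto simp: card_2_iff) (metis insert_subset)
  define W where "W = ?V - {r}"
  have "W \<noteq> {}"
    using r by (auto simp: W_def)
  have "\<exists>q (d :: 'a \<Rightarrow> nat). \<forall>v\<in>W. q v \<in> ?V \<and> {v, q v} \<in> F i \<and> d (q v) < d v" if "i < k" for i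
    unfolding W_def using conn[OF that] r(1) F[OF that] simple_graph_edge(1)[OF G]
    by (intro ex_parent) auto
  then obtain q and d :: "nat \<Rightarrow> 'a \<Rightarrow> nat" where
    qd: "\<And>i v. i < k \<Longrightarrow> v \<in> W \<Longrightarrow> q i v \<in> ?V \<and> {v, q i v} \<in> F i \<and> d i (q i v) < d i v"
    by metis
  \<comment> \<open>\<open>q i v\<close> is the parent of \<open>v\<close>, so \<open>I i\<close>
    consists of the edges of a spanning tree of \<open>G\<close>, each named by its child
    end.\<close>
  define p where "p i v = {v, q i v}" for i v
  define I where "I i = p i ` W" for i
  have IF: "I i \<subseteq> F i" if "i < k" for i
    using qd[OF that] by (auto simp: I_def p_def)
  have IE: "I i \<subseteq> ?E" if "i < k" for i
    using IF F that by blast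
  have Idisj: "I i \<inter> I j = {}" if "i < k" "j < k" "i \<noteq> j" for i j
    using IF disj that by blast
  have inj: "u = v" if "i < k" "p i u = p i v" "u \<in> W" "v \<in> W" for i u v
    using qd[of i u] qd[of i v] that by (auto simp: p_def doubleton_eq_iff)
  \<comment> \<open>A child of the root: a vertex of \<open>W\<close> with least \<open>d i\<close>,
    whose parent has a smaller value and so cannot lie in \<open>W\<close>.\<close>
  have "\<exists>s\<in>W. q i s = r" if i: "i < k" for i
  proof -
    obtain s where s: "s \<in> W" "\<And>v. v \<in> W \<Longrightarrow> d i s \<le> d i v"
      using ex_has_least_nat[of "\<lambda>v. v \<in> W" _ "d i"] \<open>W \<noteq> {}\<close> by blast
    then have "q i s \<notin> W"
      using qd[OF i s(1)] by (meson leD)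
    then show ?thesis
      using qd[OF i s(1)] s(1) by (auto simp: W_def)
  qed
  then obtain s where s: "\<And>i. i < k \<Longrightarrow> s i \<in> W \<and> q i (s i) = r"
    by metis
  \<comment> \<open>The edges of the \<open>i\<close>-th tree at the root \<open>r\<close> are all hung onto \<open>p i (s i)\<close>, the root of the
    tree built in the line graph.\<close>
  define up where "up i x = (if x = r then p i (s i) else p i x)" for i x
  have up: "up i x \<in> I i" "x \<in> up i x" if "i < k" "x \<in> ?V" for i x
    using that s[of i] by (auto simp: up_def I_def W_def p_def)
  \<comment> \<open>The test \<open>j < i\<close> also sends \<open>j = i\<close> to the parent end,
    so that a tree edge hangs on the edge above it. An edge in none of the trees may use either
    end.\<close>
  define ok where "ok i f x \<longleftrightarrow> x \<in> f \<and>
    (\<forall>j<k. \<forall>v\<in>W. f = p j v \<longrightarrow> x = (if j < i then v else q j v))" for i f x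
  \<comment> \<open>The condition is consistent because a tree edge determines its tree and its
    child end.\<close>
  have ex_ok: "\<exists>x. ok i f x"
    if "f \<in> ?E" for i f
  proof (cases "\<exists>j<k. f \<in> I j")
    case True
    then obtain j v where jv: "j < k" "v \<in> W" "f = p j v"
      by (auto simp: I_def)
    have "j' = j \<and> v' = v" if "j' < k" "v' \<in> W" "f = p j' v'" for j' v'
    proof -
      have "j' = j"
        using Idisj[of j' j] jv that by (auto simp: I_def)
      then show ?thesis
        using inj jv that by auto
    qed
    then show ?thesis
      using jv by (intro exI[of _ "if j < i then v else q j v"]) (auto simp: ok_def p_def)
  next
    case False
    have "f \<noteq> {}"
      using simple_graph_edge(2)[OF G that] by auto
    then obtain x where "x \<in> f"
      by blast
    with False show ?thesis
      by (intro exI[of _ x]) (auto simp: ok_def I_def)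
  qed
  define at where "at i f = (SOME x. ok i f x)" for i f
  have ok: "ok i f (at i f)" if "f \<in> ?E" for i f
    unfolding at_def using ex_ok[OF that] by (rule someI_ex)
  have at: "at i f \<in> f" if "f \<in> ?E" for i f
    using ok[OF that] by (simp add: ok_def)
  define par where "par i f = up i (at i f)" for i f
  have atV: "at i f \<in> ?V" if "f \<in> ?E" for i f
    using at[OF that] simple_graph_edge(1)[OF G that] by blast
  have parI: "par i f \<in> I i" if "i < k" "f \<in> ?E" for i f
    using up(1) atV that by (simp add: par_def)
  have par_p: "par i (p j v) = up i (if j < i then v else q j v)" if "j < k" "v \<in> W" for i j v
  proof -
    have "p j v \<in> ?E"
      using IE[of j] that by (auto simp: I_def)
    then show ?thesis
      using ok[of "p j v" i] that by (simp add: ok_def par_def)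
  qed
  \<comment> \<open>Height of a tree edge, measured at its child end. The edge
    \<open>p i (s i)\<close> gets 0 because the other tree edges at \<open>r\<close> hang on it,
    although their child ends need not have a larger value of \<open>d i\<close> than
    \<open>s i\<close>.\<close>
  define h where "h i f = (if f = p i (s i) then 0 else d i (inv_into W (p i) f))" for i f
  define rank where "rank i f = (if f \<in> I i then h i f else Suc (h i (par i f)))" for i f
  have h: "h i (p i v) = (if v = s i then 0 else d i v)" if "i < k" "v \<in> W" for i v
  proof -
    have "inj_on (p i) W"
      using inj[OF that(1)] by (auto simp: inj_on_def)
    then show ?thesis
      using that s[OF that(1)] by (auto simp: h_def inj_on_eq_iff)
  qed
  have rank: "rank i (par i f) < rank i f" if i: "i < k" and f: "f \<in> ?E" "f \<noteq> p i (s i)" for i f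
  proof (cases "f \<in> I i")
    case True
    then obtain v where v: "v \<in> W" "f = p i v"
      by (auto simp: I_def)
    then have "v \<noteq> s i"
      using f by auto
    have "h i (up i (q i v)) < d i v"
      using qd[OF i v(1)] h[OF i] s[OF i] by (auto simp: up_def W_def)
    then show ?thesis
      using True parI[OF i f(1)] par_p[OF i v(1), of i] v h[OF i v(1)] \<open>v \<noteq> s i\<close>
      by (simp add: rank_def)
  next
    case False
    then show ?thesis
      using parI[OF i f(1)] by (simp add: rank_def)
  qed
  define T where "T i = Graph ?E ((\<lambda>f. {f, par i f}) ` (?E - {p i (s i)}))" for i
  \<comment> \<open>In the \<open>j\<close>-th tree \<open>g\<close> hangs at its child end, so
    \<open>f\<close> and \<open>g\<close> have the same child end \<open>v\<close>. In the
    \<open>i\<close>-th tree \<open>f\<close> hangs at its parent end, so \<open>g\<close> leads up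
    from \<open>q j v\<close> as well as from \<open>v\<close>, which is impossible unless
    \<open>q j v = r\<close>.\<close>
  have no_mutual: False
    if ij: "i < j" "j < k" and f: "f \<in> ?E" "g \<in> ?E" "f = par j g" "g = par i f" for i j f g
  proof -
    have "i < k"
      using ij by simp
    have "f \<in> I j" "g \<in> I i"
      using parI f ij by (metis, metis \<open>i < k\<close>)
    then obtain u v where uv: "u \<in> W" "g = p i u" "v \<in> W" "f = p j v"
      by (auto simp: I_def)
    have "p j v = p j u"
      using f(3) par_p[OF \<open>i < k\<close> uv(1), of j] ij uv by (auto simp: up_def W_def)
    then have "u = v"
      using inj[OF ij(2)] uv by metis
    have g: "p i v = up i (q j v)"
      using f(4) par_p[OF ij(2) uv(3), of i] ij uv \<open>u = v\<close> by simp
    show False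
    proof (cases "q j v = r")
      case True
      \<comment> \<open>At \<open>r\<close> the edge \<open>up i r\<close> is
        \<open>p i (s i)\<close>, so both edges join \<open>v\<close> to \<open>r\<close>, though
        different trees share no edge.\<close>
      then have "v = s i"
        using g inj[OF \<open>i < k\<close>] uv s[OF \<open>i < k\<close>] by (simp add: up_def)
      then have "f = g"
        using uv \<open>u = v\<close> True s[OF \<open>i < k\<close>] by (simp add: p_def)
      then show False
        using \<open>f \<in> I j\<close> \<open>g \<in> I i\<close> Idisj[OF \<open>i < k\<close> ij(2)] ij by auto
    next
      case False
      then have "q j v = v"
        using g inj[OF \<open>i < k\<close>, of v "q j v"] uv qd[OF ij(2) uv(3)] by (auto simp: up_def W_def)
      then show False
        using qd[OF ij(2) uv(3)] by simp
    qed
  qed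
  have "completely_independent_spanning_trees (line_graph G) k T"
  proof (rule completely_independent_spanning_treesI)
    fix i
    assume i: "i < k"
    have root: "p i (s i) \<in> ?E"
      using IE[OF i] s[OF i] by (auto simp: I_def)
    have "tree (T i)"
      unfolding T_def using finite_edges[OF G] root
      by (rule tree_of_parent[where rank = "rank i"])
        (use rank[OF i] parI[OF i] IE[OF i] in auto)
    moreover have "{f, par i f} \<in> edges (line_graph G)" if f: "f \<in> ?E" "f \<noteq> p i (s i)" for f
    proof -
      have "par i f \<in> ?E" "f \<noteq> par i f"
        using parI[OF i f(1)] IE[OF i] rank[OF i f] by auto
      moreover have "at i f \<in> f \<inter> par i f"
        using at[OF f(1)] up(2)[OF i atV[OF f(1)]] by (simp add: par_def)
      ultimately show ?thesis
        using f(1) by (auto simp: line_graph_def)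
    qed
    ultimately show "spanning_tree (line_graph G) (T i)"
      by (auto simp: spanning_tree_def T_def line_graph_def)
  next
    fix i j
    assume ij: "i < k" "j < k" "i \<noteq> j"
    \<comment> \<open>A common edge either has the same child \<open>f\<close> in both trees, with
      its two parents in disjoint sets, or makes \<open>f\<close> and \<open>g\<close> parents of
      each other, which \<open>no_mutual\<close> excludes.\<close>
    have "False" if fg: "f \<in> ?E" "g \<in> ?E" "{f, par i f} = {g, par j g}" for f g
    proof (cases "f = g")
      case True
      then have "par i f = par j f"
        using fg by (auto simp: doubleton_eq_iff)
      then show False
        using parI[OF ij(1) fg(1)] parI[OF ij(2) fg(1)] Idisj[OF ij] by auto
    next
      case False
      then have "f = par j g" "g = par i f"
        using fg by (auto simp: doubleton_eq_iff)
      then show False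
        using no_mutual[of i j f g] no_mutual[of j i g f] ij fg by (meson linorder_neqE_nat)
    qed
    then show "edges (T i) \<inter> edges (T j) = {}"
      by (auto simp: T_def)
  next
    show "I i \<inter> I j = {}" if "i < k" "j < k" "i \<noteq> j" for i j
      using Idisj that .
  next
    fix i x y z
    assume i: "i < k" and x: "x \<notin> I i" "{x, y} \<in> edges (T i)" "{x, z} \<in> edges (T i)"
    \<comment> \<open>A vertex outside \<open>I i\<close> is nobody's parent, so its only neighbour
      is its own parent.\<close>
    have nbr: "w = par i x" if "{x, w} \<in> edges (T i)" for w
      using that x(1) parI[OF i] by (auto simp: T_def doubleton_eq_iff)
    show "y = z"
      using nbr[OF x(2)] nbr[OF x(3)] by simp
  qed
  then show ?thesis by blast
qed

theorem theorem4:
  fixes G :: "'a graph" and k :: nat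
  assumes "simple_graph G"
    and "2 \<le> k"
    and "k_connected (2 * k) (line_graph G)"
    and "(connected_graph G \<and> \<not> super_edge_connected G) \<or> 2 * k \<le> min_degree G"
  shows "\<exists>T. completely_independent_spanning_trees (line_graph G) k T"
proof -
  have "2 * k \<le> card (boundary (edges G) X)" if "X \<noteq> {}" "X \<subset> verts G" for X
    using card_boundary_ge[OF assms(1,3,4) that] .
  then obtain F where F: "\<And>i. i < k \<Longrightarrow> F i \<subseteq> edges G"
    "\<And>i j. i < k \<Longrightarrow> j < k \<Longrightarrow> i \<noteq> j \<Longrightarrow> F i \<inter> F j = {}"
    "\<And>i. i < k \<Longrightarrow> verts G \<times> verts G \<subseteq> conn (F i)"
    using tree_packing[of "verts G" "edges G" k] assms(1) by (auto simp: simple_graph_def)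
  \<comment> \<open>Without edges the line graph would have no vertices and hence connectivity
    0.\<close>
  have "edges G \<noteq> {}"
    using k_connectedD[OF assms(3), of "{}"] assms(2) by (auto simp: line_graph_def)
  then show ?thesis
    using line_graph_cist[OF assms(1)] F by blast
qed

end
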